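(* For any disjoint predicate structures $\mathcal{M}_1$ and $\mathcal{M}_2$, and a set $A\subseteq M_1\cup M_2$, $$\mathrm{ind}_{\mathrm{rig}}((\mathcal{M}_1\sqcup\mathcal{M}_2)/A)=\max\{\mathrm{ind}_{\mathrm{rig}}(\mathcal{M}_1/(M_1\cap A)),\ \mathrm{ind}_{\mathrm{rig}}(\mathcal{M}_2/(M_2\cap A))\}.$$
   Context: The universe of $\mathcal{M}$ is denoted $M$ (and of $\mathcal{M}_i$ by $M_i$). Disjoint union: for structures $\mathcal{M}_1,\mathcal{M}_2$ with disjoint universes and disjoint predicate (relational) languages $\Sigma_1,\Sigma_2$, $\mathcal{M}_1\sqcup\mathcal{M}_2$ is the structure of language $\Sigma_1\cup\Sigma_2\cup\{P_1,P_2\}$, with new unary predicates $P_1,P_2$, with universe $M_1\sqcup M_2$, $P_i=M_i$, and interpretations of the symbols of $\Sigma_i$ coinciding with their interpretations in $\mathcal{M}_i$, $i=1,2$. For a set $A$ in a structure $\mathcal{M}$, the index of rigidity of $\mathcal{M}$ over $A$, denoted $\mathrm{ind}_{\mathrm{rig}}(\mathcal{M}/A)$, is the supremum of the cardinalities of the sets of solutions of algebraic types $\mathrm{tp}(a/A)$ for $a\in M$ (a type is algebraic if it contains a formula with only finitely many solutions); it is $0$ if there are no such algebraic types. Thus $\mathrm{ind}_{\mathrm{rig}}(\mathcal{M}/A)\in\omega+1$. *)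

theory Defs
  imports Main "HOL-Library.Extended_Nat"
begin

text \<open>
  First-order structures of a predicate (purely relational) language. The language is the
  set \<open>lang M\<close> of predicate symbols together with their arities; values of \<open>arity\<close> and
  \<open>rel\<close> outside \<open>lang M\<close> are irrelevant.
\<close>

record ('a, 'p) pstruct =
  univ :: "'a set"
  lang :: "'p set"
  arity :: "'p \<Rightarrow> nat"
  rel :: "'p \<Rightarrow> 'a list set"

definition pred_structure :: "('a, 'p) pstruct \<Rightarrow> bool" where
  "pred_structure M \<longleftrightarrow>
     univ M \<noteq> {} \<and>
     (\<forall>p\<in>lang M. \<forall>xs\<in>rel M p. length xs = arity M p \<and> set xs \<subseteq> univ M)"

text \<open>
  Formulas with equality and with parameters: \<open>Par c\<close> is the constant naming the element
  \<open>c\<close>. The remaining connectives and the universal quantifier are definable as usual.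
\<close>

datatype 'a trm = Var nat | Par 'a

datatype ('a, 'p) fm =
    Eq "'a trm" "'a trm"
  | Pred 'p "'a trm list"
  | Neg "('a, 'p) fm"
  | Conj "('a, 'p) fm" "('a, 'p) fm"
  | Ex nat "('a, 'p) fm"

primrec val :: "(nat \<Rightarrow> 'a) \<Rightarrow> 'a trm \<Rightarrow> 'a" where
  "val e (Var n) = e n"
| "val e (Par c) = c"

primrec sat :: "('a, 'p) pstruct \<Rightarrow> (nat \<Rightarrow> 'a) \<Rightarrow> ('a, 'p) fm \<Rightarrow> bool" where
  "sat M e (Eq s t) \<longleftrightarrow> val e s = val e t"
| "sat M e (Pred p ts) \<longleftrightarrow> map (val e) ts \<in> rel M p"
| "sat M e (Neg \<phi>) \<longleftrightarrow> \<not> sat M e \<phi>"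
| "sat M e (Conj \<phi> \<psi>) \<longleftrightarrow> sat M e \<phi> \<and> sat M e \<psi>"
| "sat M e (Ex n \<phi>) \<longleftrightarrow> (\<exists>b\<in>univ M. sat M (e(n := b)) \<phi>)"

primrec fv_trm :: "'a trm \<Rightarrow> nat set" where
  "fv_trm (Var n) = {n}"
| "fv_trm (Par c) = {}"

primrec fv :: "('a, 'p) fm \<Rightarrow> nat set" where
  "fv (Eq s t) = fv_trm s \<union> fv_trm t"
| "fv (Pred p ts) = (\<Union>t\<in>set ts. fv_trm t)"
| "fv (Neg \<phi>) = fv \<phi>"
| "fv (Conj \<phi> \<psi>) = fv \<phi> \<union> fv \<psi>"
| "fv (Ex n \<phi>) = fv \<phi> - {n}"

primrec trm_over :: "'a set \<Rightarrow> 'a trm \<Rightarrow> bool" where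
  "trm_over A (Var n) \<longleftrightarrow> True"
| "trm_over A (Par c) \<longleftrightarrow> c \<in> A"

text \<open>\<open>fm_over M A \<phi>\<close>: \<open>\<phi>\<close> is a formula of the language of \<open>M\<close> with parameters from \<open>A\<close>.\<close>

primrec fm_over :: "('a, 'p) pstruct \<Rightarrow> 'a set \<Rightarrow> ('a, 'p) fm \<Rightarrow> bool" where
  "fm_over M A (Eq s t) \<longleftrightarrow> trm_over A s \<and> trm_over A t"
| "fm_over M A (Pred p ts) \<longleftrightarrow>
     p \<in> lang M \<and> length ts = arity M p \<and> (\<forall>t\<in>set ts. trm_over A t)"
| "fm_over M A (Neg \<phi>) \<longleftrightarrow> fm_over M A \<phi>"
| "fm_over M A (Conj \<phi> \<psi>) \<longleftrightarrow> fm_over M A \<phi> \<and> fm_over M A \<psi>"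
| "fm_over M A (Ex n \<phi>) \<longleftrightarrow> fm_over M A \<phi>"

text \<open>
  The free variable of a formula in one variable is variable 0. Since nothing else occurs
  free, the constant assignment below merely assigns \<open>a\<close> to that variable.
\<close>

definition holds_at :: "('a, 'p) pstruct \<Rightarrow> ('a, 'p) fm \<Rightarrow> 'a \<Rightarrow> bool" where
  "holds_at M \<phi> a \<longleftrightarrow> sat M (\<lambda>_. a) \<phi>"

definition tp :: "('a, 'p) pstruct \<Rightarrow> 'a set \<Rightarrow> 'a \<Rightarrow> ('a, 'p) fm set" where
  "tp M A a = {\<phi>. fm_over M A \<phi> \<and> fv \<phi> \<subseteq> {0} \<and> holds_at M \<phi> a}"

definition solutions :: "('a, 'p) pstruct \<Rightarrow> ('a, 'p) fm set \<Rightarrow> 'a set" where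
  "solutions M p = {b \<in> univ M. \<forall>\<phi>\<in>p. holds_at M \<phi> b}"

definition algebraic_type :: "('a, 'p) pstruct \<Rightarrow> ('a, 'p) fm set \<Rightarrow> bool" where
  "algebraic_type M p \<longleftrightarrow> (\<exists>\<phi>\<in>p. finite {b \<in> univ M. holds_at M \<phi> b})"

text \<open>
  Values in \<open>enat\<close> represent elements of \<open>\<omega> + 1\<close>. Solution sets of algebraic types are
  finite, so \<open>card\<close> is their true cardinality; the supremum of the empty set is 0.
\<close>

definition ind_rig :: "('a, 'p) pstruct \<Rightarrow> 'a set \<Rightarrow> enat" where
  "ind_rig M A =
     (SUP a\<in>{a \<in> univ M. algebraic_type M (tp M A a)}. enat (card (solutions M (tp M A a))))"

text \<open>
  The disjoint union with new unary predicate symbols \<open>P1\<close> and \<open>P2\<close>; meaningful when the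
  universes and the languages are disjoint and \<open>P1\<close>, \<open>P2\<close> are distinct and fresh.
\<close>

definition disjoint_union ::
  "'p \<Rightarrow> 'p \<Rightarrow> ('a, 'p) pstruct \<Rightarrow> ('a, 'p) pstruct \<Rightarrow> ('a, 'p) pstruct" where
  "disjoint_union P1 P2 M1 M2 =
     \<lparr> univ = univ M1 \<union> univ M2,
       lang = lang M1 \<union> lang M2 \<union> {P1, P2},
       arity = (\<lambda>p. if p = P1 \<or> p = P2 then 1
                     else if p \<in> lang M1 then arity M1 p else arity M2 p),
       rel = (\<lambda>p. if p = P1 then {[x] | x. x \<in> univ M1}
                   else if p = P2 then {[x] | x. x \<in> univ M2}
                   else if p \<in> lang M1 then rel M1 p else rel M2 p) \<rparr>"

lemma pred_structure_disjoint_union: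
  assumes "pred_structure M1" "pred_structure M2"
  shows "pred_structure (disjoint_union P1 P2 M1 M2)"
  using assms unfolding pred_structure_def disjoint_union_def
  by (auto; blast)

end

theory Submission
  imports Defs
begin

text \<open>
  The solution set of \<open>tp(a/A)\<close> is the intersection of all \<open>A\<close>-definable sets containing \<open>a\<close>,
  and the type is algebraic iff one of these sets is finite. So the index of rigidity depends only
  on the family of \<open>A\<close>-definable subsets of the structure. For \<open>a \<in> M\<^sub>1\<close> the disjoint union
  contributes exactly the \<open>A\<close>-definable subsets of \<open>M\<^sub>1\<close>, because \<open>M\<^sub>1\<close> itself is defined by the
  predicate \<open>P\<^sub>1\<close>, and the theorem reduces to the following fact: a subset of \<open>M\<^sub>1\<close> is
  \<open>A\<close>-definable in the disjoint union iff it is \<open>M\<^sub>1 \<inter> A\<close>-definable in \<open>M\<^sub>1\<close>. The same holds on the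
  other side by symmetry, and the supremum over \<open>M\<^sub>1 \<union> M\<^sub>2\<close> is the maximum of the two suprema.

  From \<open>M\<^sub>1\<close> to the disjoint union, one relativises quantifiers to \<open>P\<^sub>1\<close>
  (\<open>definable_in_sum\<close>). The converse (\<open>definable_trace\<close>) is a weak form of the Feferman--Vaught
  theorem: split the variables of a formula of the disjoint union into those ranging over \<open>M\<^sub>1\<close>
  and those ranging over \<open>M\<^sub>2\<close>. When the latter are given values, the formula becomes
  equivalent to a formula of \<open>M\<^sub>1\<close> in the former, and as these values vary only finitely many
  formulas of \<open>M\<^sub>1\<close> arise (\<open>finitely_many_traces\<close>). The finiteness is what makes the induction work:
  a quantifier over \<open>M\<^sub>2\<close> turns into a finite disjunction of formulas of \<open>M\<^sub>1\<close>.
\<close>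

section \<open>Formulas\<close>

lemma val_cong: "(\<And>i. i \<in> fv_trm t \<Longrightarrow> e i = e' i) \<Longrightarrow> val e t = val e' t"
  by (cases t) auto

lemma sat_cong: "(\<And>i. i \<in> fv \<phi> \<Longrightarrow> e i = e' i) \<Longrightarrow> sat M e \<phi> \<longleftrightarrow> sat M e' \<phi>"
proof (induction \<phi> arbitrary: e e')
  case (Eq s t)
  then have "val e s = val e' s" "val e t = val e' t"
    by (auto intro!: val_cong)
  then show ?case by simp
next
  case (Pred p ts)
  then have "map (val e) ts = map (val e') ts"
    by (auto intro!: val_cong)
  then show ?case by (simp del: map_eq_conv)
next
  case (Neg \<phi>)
  from Neg.IH[of e e'] Neg.prems show ?case by simp
next
  case (Conj \<phi> \<psi>)
  from Conj.IH(1)[of e e'] Conj.IH(2)[of e e'] Conj.prems show ?case by simp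
next
  case (Ex n \<phi>)
  have "sat M (e(n := b)) \<phi> \<longleftrightarrow> sat M (e'(n := b)) \<phi>" for b
    using Ex.prems by (intro Ex.IH) auto
  then show ?case by simp
qed

text \<open>The quantifier makes the false formula closed, also when there are no parameters.\<close>

definition Bot :: "('a, 'p) fm" where
  "Bot = Ex 0 (Neg (Eq (Var 0) (Var 0)))"

definition Disj :: "('a, 'p) fm \<Rightarrow> ('a, 'p) fm \<Rightarrow> ('a, 'p) fm" where
  "Disj \<phi> \<psi> = Neg (Conj (Neg \<phi>) (Neg \<psi>))"

lemma Bot_simps [simp]: "sat M e Bot \<longleftrightarrow> False" "fv Bot = {}" "fm_over M A Bot"
  by (auto simp: Bot_def)

lemma Disj_simps [simp]:
  "sat M e (Disj \<phi> \<psi>) \<longleftrightarrow> sat M e \<phi> \<or> sat M e \<psi>"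
  "fv (Disj \<phi> \<psi>) = fv \<phi> \<union> fv \<psi>"
  "fm_over M A (Disj \<phi> \<psi>) \<longleftrightarrow> fm_over M A \<phi> \<and> fm_over M A \<psi>"
  by (auto simp: Disj_def)

lemma finite_disjunction:
  assumes "finite T" and "\<forall>\<alpha>\<in>T. fm_over M A \<alpha> \<and> fv \<alpha> \<subseteq> S"
  shows "\<exists>\<delta>. fm_over M A \<delta> \<and> fv \<delta> \<subseteq> S \<and> (\<forall>e. sat M e \<delta> \<longleftrightarrow> (\<exists>\<alpha>\<in>T. sat M e \<alpha>))"
  using assms
proof (induction T)
  case empty
  show ?case by (rule exI[of _ Bot]) simp
next
  case (insert \<alpha> T)
  then obtain \<delta> where "fm_over M A \<delta>" "fv \<delta> \<subseteq> S" "\<forall>e. sat M e \<delta> \<longleftrightarrow> (\<exists>\<alpha>\<in>T. sat M e \<alpha>)"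
    by auto
  with insert.prems show ?case by (intro exI[of _ "Disj \<alpha> \<delta>"]) auto
qed

section \<open>Types and definable sets\<close>

definition definable_sets :: "('a, 'p) pstruct \<Rightarrow> 'a set \<Rightarrow> 'a set set" where
  "definable_sets M A =
     {{b \<in> univ M. holds_at M \<phi> b} | \<phi>. fm_over M A \<phi> \<and> fv \<phi> \<subseteq> {0}}"

lemma solutions_tp_eq:
  assumes "a \<in> univ M"
  shows "solutions M (tp M A a) = {b \<in> univ M. \<forall>D\<in>definable_sets M A. a \<in> D \<longrightarrow> b \<in> D}"
  using assms unfolding solutions_def tp_def definable_sets_def by auto

lemma algebraic_tp_iff:
  assumes "a \<in> univ M"
  shows "algebraic_type M (tp M A a) \<longleftrightarrow> (\<exists>D\<in>definable_sets M A. a \<in> D \<and> finite D)"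
  using assms unfolding algebraic_type_def tp_def definable_sets_def by auto

lemma univ_definable: "univ M \<in> definable_sets M A"
  unfolding definable_sets_def holds_at_def
  by (rule CollectI, rule exI[of _ "Neg Bot"]) simp

section \<open>Disjoint sums\<close>

text \<open>
  Unlike the construction \<open>disjoint_union\<close>, which treats symbols outside both languages
  asymmetrically, this characterisation is symmetric in the two summands, so that every result
  about the first one carries over to the second.
\<close>

locale disjoint_sum =
  fixes U M1 M2 :: "('a, 'p) pstruct" and P1 P2 :: 'p
  assumes structures: "pred_structure M1" "pred_structure M2"
    and disjoint: "univ M1 \<inter> univ M2 = {}"
    and univ_sum: "univ U = univ M1 \<union> univ M2"
    and lang_sum: "lang U = lang M1 \<union> lang M2 \<union> {P1, P2}"
    and arity_sum: "p \<in> lang M1 \<Longrightarrow> arity U p = arity M1 p"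
      "p \<in> lang M2 \<Longrightarrow> arity U p = arity M2 p"
      "arity U P1 = 1" "arity U P2 = 1"
    and rel_sum: "p \<in> lang M1 \<Longrightarrow> rel U p = rel M1 p"
      "p \<in> lang M2 \<Longrightarrow> rel U p = rel M2 p"
      "rel U P1 = {[x] | x. x \<in> univ M1}" "rel U P2 = {[x] | x. x \<in> univ M2}"

lemma disjoint_sum_commute:
  assumes "disjoint_sum U M1 M2 P1 P2"
  shows "disjoint_sum U M2 M1 P2 P1"
  using assms unfolding disjoint_sum_def by (simp add: Un_ac Int_commute insert_commute)

lemma disjoint_sum_disjoint_union:
  assumes "pred_structure M1" "pred_structure M2" "univ M1 \<inter> univ M2 = {}"
    and "lang M1 \<inter> lang M2 = {}"
    and "P1 \<notin> lang M1 \<union> lang M2" "P2 \<notin> lang M1 \<union> lang M2" "P1 \<noteq> P2"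
  shows "disjoint_sum (disjoint_union P1 P2 M1 M2) M1 M2 P1 P2"
  using assms unfolding disjoint_sum_def disjoint_union_def by auto

context disjoint_sum
begin

lemma rel_in_univ:
  "p \<in> lang M1 \<Longrightarrow> xs \<in> rel U p \<Longrightarrow> set xs \<subseteq> univ M1"
  "p \<in> lang M2 \<Longrightarrow> xs \<in> rel U p \<Longrightarrow> set xs \<subseteq> univ M2"
  using structures rel_sum(1,2) unfolding pred_structure_def by blast+

subsection \<open>Relativisation\<close>

primrec relativise :: "('a, 'p) fm \<Rightarrow> ('a, 'p) fm" where
  "relativise (Eq s t) = Eq s t"
| "relativise (Pred p ts) = Pred p ts"
| "relativise (Neg \<phi>) = Neg (relativise \<phi>)"
| "relativise (Conj \<phi> \<psi>) = Conj (relativise \<phi>) (relativise \<psi>)"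
| "relativise (Ex n \<phi>) = Ex n (Conj (Pred P1 [Var n]) (relativise \<phi>))"

lemma fv_relativise: "fv (relativise \<phi>) = fv \<phi>"
  by (induction \<phi>) auto

lemma trm_over_mono: "trm_over B t \<Longrightarrow> B \<subseteq> A \<Longrightarrow> trm_over A t"
  by (cases t) auto

lemma fm_over_relativise: "fm_over M1 (univ M1 \<inter> A) \<phi> \<Longrightarrow> fm_over U A (relativise \<phi>)"
  by (induction \<phi>) (auto simp: lang_sum arity_sum intro: trm_over_mono)

lemma sat_relativise:
  assumes "fm_over M1 A \<phi>" and "\<forall>i. e i \<in> univ M1"
  shows "sat U e (relativise \<phi>) \<longleftrightarrow> sat M1 e \<phi>"
  using assms
proof (induction \<phi> arbitrary: e)
  case (Ex n \<phi>)
  then have "sat U (e(n := b)) (relativise \<phi>) \<longleftrightarrow> sat M1 (e(n := b)) \<phi>" if "b \<in> univ M1" for b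
    using that by simp
  then show ?case by (auto simp: univ_sum rel_sum)
qed (auto simp: rel_sum)

text \<open>
  Relativisation alone does not suffice: the relativised formula may also hold at elements of the
  second summand, and these are removed by the conjunct \<open>P\<^sub>1(x\<^sub>0)\<close>.
\<close>

lemma definable_in_sum:
  assumes "D \<in> definable_sets M1 (univ M1 \<inter> A)"
  shows "D \<in> definable_sets U A"
proof -
  obtain \<phi> where \<phi>: "fm_over M1 (univ M1 \<inter> A) \<phi>" "fv \<phi> \<subseteq> {0}"
    and D: "D = {b \<in> univ M1. holds_at M1 \<phi> b}"
    using assms unfolding definable_sets_def by blast
  let ?\<psi> = "Conj (Pred P1 [Var 0]) (relativise \<phi>)"
  have "D = {b \<in> univ U. holds_at U ?\<psi> b}"
    using sat_relativise[OF \<phi>(1)] by (auto simp: D holds_at_def univ_sum rel_sum)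
  moreover have "fm_over U A ?\<psi>" "fv ?\<psi> \<subseteq> {0}"
    using \<phi> by (auto simp: fm_over_relativise fv_relativise lang_sum arity_sum)
  ultimately show ?thesis unfolding definable_sets_def by blast
qed

subsection \<open>Traces on the first summand\<close>

definition sorted_env :: "nat set \<Rightarrow> (nat \<Rightarrow> 'a) \<Rightarrow> bool" where
  "sorted_env S e \<longleftrightarrow> (\<forall>i. e i \<in> (if i \<in> S then univ M1 else univ M2))"

lemma sorted_env_update:
  assumes "sorted_env S e"
  shows "b \<in> univ M1 \<Longrightarrow> sorted_env (insert n S) (e(n := b))"
    and "b \<in> univ M2 \<Longrightarrow> sorted_env (S - {n}) (e(n := b))"
  using assms unfolding sorted_env_def by (auto split: if_splits)

text \<open>
  For fixed values \<open>c\<close> of the variables outside \<open>S\<close>, the formula \<open>\<alpha>\<close> of the first summand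
  expresses \<open>\<phi>\<close> as a condition on the variables in \<open>S\<close>.
\<close>

definition traces :: "nat set \<Rightarrow> ('a, 'p) fm \<Rightarrow> (nat \<Rightarrow> 'a) \<Rightarrow> ('a, 'p) fm \<Rightarrow> bool" where
  "traces S \<phi> c \<alpha> \<longleftrightarrow>
     (\<forall>e. sorted_env S e \<longrightarrow> (\<forall>i. i \<notin> S \<longrightarrow> e i = c i) \<longrightarrow> (sat U e \<phi> \<longleftrightarrow> sat M1 e \<alpha>))"

lemma tracesD:
  assumes "traces S \<phi> c \<alpha>" "sorted_env S e" "\<And>i. i \<notin> S \<Longrightarrow> e i = c i"
  shows "sat U e \<phi> \<longleftrightarrow> sat M1 e \<alpha>"
  using assms unfolding traces_def by blast

definition finitely_traced :: "'a set \<Rightarrow> nat set \<Rightarrow> ('a, 'p) fm \<Rightarrow> bool" where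
  "finitely_traced A S \<phi> \<longleftrightarrow>
     (\<exists>F. finite F \<and> (\<forall>\<alpha>\<in>F. fm_over M1 (univ M1 \<inter> A) \<alpha> \<and> fv \<alpha> \<subseteq> S) \<and>
          (\<forall>c. sorted_env S c \<longrightarrow> (\<exists>\<alpha>\<in>F. traces S \<phi> c \<alpha>)))"

lemma finitely_traced_same:
  assumes "fm_over M1 (univ M1 \<inter> A) \<phi>" "fv \<phi> \<subseteq> S"
    and "\<And>e. sorted_env S e \<Longrightarrow> sat U e \<phi> \<longleftrightarrow> sat M1 e \<phi>"
  shows "finitely_traced A S \<phi>"
  unfolding finitely_traced_def traces_def using assms by (intro exI[of _ "{\<phi>}"]) auto

text \<open>
  A formula whose truth value is determined by the values outside \<open>S\<close> has only the traces true
  and false, whichever conditions on the second summand it imposes.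
\<close>

lemma finitely_traced_const:
  assumes "\<And>e e'. sorted_env S e \<Longrightarrow> sorted_env S e' \<Longrightarrow> (\<forall>i. i \<notin> S \<longrightarrow> e i = e' i) \<Longrightarrow>
    sat U e \<phi> \<Longrightarrow> sat U e' \<phi>"
  shows "finitely_traced A S \<phi>"
  unfolding finitely_traced_def
proof (intro exI[of _ "{Bot, Neg Bot}"] conjI allI impI)
  fix c assume c: "sorted_env S c"
  have "sat U e \<phi> \<longleftrightarrow> sat U c \<phi>" if "sorted_env S e" "\<forall>i. i \<notin> S \<longrightarrow> e i = c i" for e
    using assms[OF that(1) c] assms[OF c that(1)] that(2) by auto
  then show "\<exists>\<alpha>\<in>{Bot, Neg Bot}. traces S \<phi> c \<alpha>"
    unfolding traces_def by auto
qed auto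

text \<open>
  In a well-sorted environment, the values of terms are sorted as well: \<open>first_sort S t\<close> holds iff
  the value of \<open>t\<close> lies in the first summand.
\<close>

primrec first_sort :: "nat set \<Rightarrow> 'a trm \<Rightarrow> bool" where
  "first_sort S (Var n) \<longleftrightarrow> n \<in> S"
| "first_sort S (Par c) \<longleftrightarrow> c \<in> univ M1"

lemma val_sorted:
  assumes "A \<subseteq> univ U" "trm_over A t" "sorted_env S e"
  shows "val e t \<in> univ M1 \<longleftrightarrow> first_sort S t" and "val e t \<in> univ M2 \<longleftrightarrow> \<not> first_sort S t"
proof -
  show "val e t \<in> univ M1 \<longleftrightarrow> first_sort S t"
    using assms disjoint unfolding sorted_env_def by (cases t) (auto split: if_splits)
  show "val e t \<in> univ M2 \<longleftrightarrow> \<not> first_sort S t"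
    using assms disjoint univ_sum unfolding sorted_env_def by (cases t) (auto split: if_splits)
qed

lemma val_second_sort:
  assumes "\<not> first_sort S t" "\<forall>i. i \<notin> S \<longrightarrow> e i = e' i"
  shows "val e t = val e' t"
  using assms by (cases t) auto

lemma first_sort_trm:
  assumes "first_sort S t" "trm_over A t"
  shows "fv_trm t \<subseteq> S" "trm_over (univ M1 \<inter> A) t"
  using assms by (cases t; simp)+

text \<open>
  An atomic formula of the language of the first summand whose terms all take values there is its
  own trace. Any other atomic formula is determined by the values outside \<open>S\<close>: equality and the
  symbols of the two languages never relate elements of different summands, and the truth value of
  \<open>P\<^sub>1(t)\<close> or \<open>P\<^sub>2(t)\<close> depends only on the sort of \<open>t\<close>.
\<close>

lemma finitely_traced_Eq:
  assumes A: "A \<subseteq> univ U" and st: "trm_over A s" "trm_over A t"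
  shows "finitely_traced A S (Eq s t)"
proof (cases "first_sort S s \<and> first_sort S t")
  case True
  with st first_sort_trm[of S s A] first_sort_trm[of S t A] show ?thesis
    by (intro finitely_traced_same) auto
next
  case False
  show ?thesis
  proof (rule finitely_traced_const)
    fix e e' assume e: "sorted_env S e" and agree: "\<forall>i. i \<notin> S \<longrightarrow> e i = e' i"
      and "sat U e (Eq s t)"
    then have eq: "val e s = val e t" by simp
    then have "\<not> first_sort S s" "\<not> first_sort S t"
      using False val_sorted(1)[OF A st(1) e] val_sorted(1)[OF A st(2) e] by auto
    with eq agree show "sat U e' (Eq s t)"
      using val_second_sort[of S _ e e'] by simp
  qed
qed

lemma finitely_traced_Pred:
  assumes A: "A \<subseteq> univ U" and p: "fm_over U A (Pred p ts)"
  shows "finitely_traced A S (Pred p ts)"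
proof -
  note ts = val_sorted[OF A, of _ S]
  consider "p \<in> lang M1" "\<forall>t\<in>set ts. first_sort S t"
    | t where "p \<in> lang M1" "t \<in> set ts" "\<not> first_sort S t"
    | "p \<in> lang M2" | t where "p = P1 \<or> p = P2" "ts = [t]"
    using p by (auto simp: lang_sum arity_sum length_Suc_conv)
  then show ?thesis
  proof cases
    case 1
    with p first_sort_trm show ?thesis
      by (intro finitely_traced_same) (fastforce simp: arity_sum rel_sum)+
  next
    case 2
    have False if "sorted_env S e" "sat U e (Pred p ts)" for e
      using rel_in_univ(1)[OF 2(1), of "map (val e) ts"] ts(1)[of t e] 2 p that by auto
    then show ?thesis by (intro finitely_traced_const) blast
  next
    case 3
    show ?thesis
    proof (rule finitely_traced_const)
      fix e e' assume e: "sorted_env S e" and agree: "\<forall>i. i \<notin> S \<longrightarrow> e i = e' i"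
        and sat: "sat U e (Pred p ts)"
      have "\<not> first_sort S t" if "t \<in> set ts" for t
        using rel_in_univ(2)[OF 3, of "map (val e) ts"] ts(2)[of t e] that p e sat by auto
      then have "map (val e') ts = map (val e) ts"
        using val_second_sort[OF _ agree] by simp
      with sat show "sat U e' (Pred p ts)" by (simp del: map_eq_conv)
    qed
  next
    case 4
    have "trm_over A t" using p 4(2) by simp
    then show ?thesis
      using 4 ts[of t] by (intro finitely_traced_const) (auto simp: rel_sum)
  qed
qed

lemma finitely_traced_Neg:
  assumes "finitely_traced A S \<phi>"
  shows "finitely_traced A S (Neg \<phi>)"
proof -
  obtain F where "finite F" "\<forall>\<alpha>\<in>F. fm_over M1 (univ M1 \<inter> A) \<alpha> \<and> fv \<alpha> \<subseteq> S"
    "\<forall>c. sorted_env S c \<longrightarrow> (\<exists>\<alpha>\<in>F. traces S \<phi> c \<alpha>)"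
    using assms unfolding finitely_traced_def by blast
  moreover have "traces S (Neg \<phi>) c (Neg \<alpha>)" if "traces S \<phi> c \<alpha>" for c \<alpha>
    using that unfolding traces_def by simp
  ultimately show ?thesis
    unfolding finitely_traced_def by (intro exI[of _ "Neg ` F"]) (simp; blast)
qed

lemma finitely_traced_Conj:
  assumes "finitely_traced A S \<phi>" "finitely_traced A S \<psi>"
  shows "finitely_traced A S (Conj \<phi> \<psi>)"
proof -
  obtain F where F: "finite F" "\<forall>\<alpha>\<in>F. fm_over M1 (univ M1 \<inter> A) \<alpha> \<and> fv \<alpha> \<subseteq> S"
    "\<forall>c. sorted_env S c \<longrightarrow> (\<exists>\<alpha>\<in>F. traces S \<phi> c \<alpha>)"
    using assms unfolding finitely_traced_def by blast
  obtain G where G: "finite G" "\<forall>\<beta>\<in>G. fm_over M1 (univ M1 \<inter> A) \<beta> \<and> fv \<beta> \<subseteq> S"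
    "\<forall>c. sorted_env S c \<longrightarrow> (\<exists>\<beta>\<in>G. traces S \<psi> c \<beta>)"
    using assms unfolding finitely_traced_def by blast
  have *: "traces S (Conj \<phi> \<psi>) c (Conj \<alpha> \<beta>)" if "traces S \<phi> c \<alpha>" "traces S \<psi> c \<beta>" for c \<alpha> \<beta>
    using that unfolding traces_def by simp
  show ?thesis
    unfolding finitely_traced_def
  proof (intro exI[of _ "(\<lambda>(\<alpha>, \<beta>). Conj \<alpha> \<beta>) ` (F \<times> G)"] conjI allI impI)
    fix c assume "sorted_env S c"
    with F(3) G(3) obtain \<alpha> \<beta> where "\<alpha> \<in> F" "\<beta> \<in> G" "traces S \<phi> c \<alpha>" "traces S \<psi> c \<beta>"
      by blast
    with * show "\<exists>\<gamma>\<in>(\<lambda>(\<alpha>, \<beta>). Conj \<alpha> \<beta>) ` (F \<times> G). traces S (Conj \<phi> \<psi>) c \<gamma>"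
      by force
  qed (use F G in auto)
qed

text \<open>
  A quantifier over the sum splits into quantifiers over the two summands. The one over the first
  summand is kept. For the other, the trace of \<open>\<phi>\<close> at \<open>c(n := b)\<close> stays in a finite set \<open>G\<close> as \<open>b\<close>
  ranges over the second summand, so the quantifier is the disjunction of a subset of \<open>G\<close>, and
  \<open>G\<close> has only finitely many subsets.
\<close>

lemma finitely_traced_Ex:
  assumes "finitely_traced A (insert n S) \<phi>" "finitely_traced A (S - {n}) \<phi>"
  shows "finitely_traced A S (Ex n \<phi>)"
proof -
  obtain F where F: "finite F" "\<forall>\<alpha>\<in>F. fm_over M1 (univ M1 \<inter> A) \<alpha> \<and> fv \<alpha> \<subseteq> insert n S"
    "\<forall>c. sorted_env (insert n S) c \<longrightarrow> (\<exists>\<alpha>\<in>F. traces (insert n S) \<phi> c \<alpha>)"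
    using assms unfolding finitely_traced_def by blast
  obtain G where G: "finite G" "\<forall>\<beta>\<in>G. fm_over M1 (univ M1 \<inter> A) \<beta> \<and> fv \<beta> \<subseteq> S - {n}"
    "\<forall>c. sorted_env (S - {n}) c \<longrightarrow> (\<exists>\<beta>\<in>G. traces (S - {n}) \<phi> c \<beta>)"
    using assms unfolding finitely_traced_def by blast
  have "\<forall>T\<in>Pow G. \<exists>\<delta>. fm_over M1 (univ M1 \<inter> A) \<delta> \<and> fv \<delta> \<subseteq> S - {n} \<and>
      (\<forall>e. sat M1 e \<delta> \<longleftrightarrow> (\<exists>\<beta>\<in>T. sat M1 e \<beta>))"
    using G(1,2) by (intro ballI finite_disjunction) (auto intro: finite_subset)
  then obtain \<Delta> where \<Delta>: "\<And>T. T \<subseteq> G \<Longrightarrow> fm_over M1 (univ M1 \<inter> A) (\<Delta> T)"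
    "\<And>T. T \<subseteq> G \<Longrightarrow> fv (\<Delta> T) \<subseteq> S - {n}"
    "\<And>T e. T \<subseteq> G \<Longrightarrow> sat M1 e (\<Delta> T) \<longleftrightarrow> (\<exists>\<beta>\<in>T. sat M1 e \<beta>)"
    by (metis PowI)
  let ?H = "(\<lambda>(\<alpha>, T). Disj (Ex n \<alpha>) (\<Delta> T)) ` (F \<times> Pow G)"
  show ?thesis
    unfolding finitely_traced_def
  proof (intro exI[of _ ?H] conjI allI impI)
    show "finite ?H" using F(1) G(1) by simp
    show "\<forall>\<gamma>\<in>?H. fm_over M1 (univ M1 \<inter> A) \<gamma> \<and> fv \<gamma> \<subseteq> S"
    proof
      fix \<gamma> assume "\<gamma> \<in> ?H"
      then obtain \<alpha> T where \<gamma>: "\<alpha> \<in> F" "T \<subseteq> G" "\<gamma> = Disj (Ex n \<alpha>) (\<Delta> T)" by auto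
      with F(2) have "fm_over M1 (univ M1 \<inter> A) \<alpha>" "fv \<alpha> \<subseteq> insert n S" by blast+
      with \<gamma> \<Delta>(1,2)[OF \<gamma>(2)] show "fm_over M1 (univ M1 \<inter> A) \<gamma> \<and> fv \<gamma> \<subseteq> S"
        by auto
    qed
  next
    fix c assume c: "sorted_env S c"
    \<comment> \<open>The value at \<open>n\<close> is quantified, but \<open>c\<close> has to be repaired there to become well-sorted; any
      element of the first summand serves.\<close>
    obtain b0 where "b0 \<in> univ M1"
      using structures unfolding pred_structure_def by blast
    with c have "sorted_env (insert n S) (c(n := b0))"
      by (intro sorted_env_update)
    with F(3) obtain \<alpha> where \<alpha>: "\<alpha> \<in> F" "traces (insert n S) \<phi> (c(n := b0)) \<alpha>"
      by blast
    have first: "sat U (e(n := b)) \<phi> \<longleftrightarrow> sat M1 (e(n := b)) \<alpha>"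
      if "sorted_env S e" "\<forall>i. i \<notin> S \<longrightarrow> e i = c i" "b \<in> univ M1" for e b
      using sorted_env_update(1)[OF that(1,3)] that(2) by (intro tracesD[OF \<alpha>(2)]) auto
    have "sorted_env (S - {n}) (c(n := b))" if "b \<in> univ M2" for b
      using c that by (intro sorted_env_update)
    then have "\<forall>b\<in>univ M2. \<exists>\<beta>\<in>G. traces (S - {n}) \<phi> (c(n := b)) \<beta>"
      using G(3) by blast
    then obtain g where g: "\<forall>b\<in>univ M2. g b \<in> G \<and> traces (S - {n}) \<phi> (c(n := b)) (g b)"
      by metis
    have second: "sat U (e(n := b)) \<phi> \<longleftrightarrow> sat M1 e (g b)"
      if "sorted_env S e" "\<forall>i. i \<notin> S \<longrightarrow> e i = c i" "b \<in> univ M2" for e b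
    proof -
      have "sat U (e(n := b)) \<phi> \<longleftrightarrow> sat M1 (e(n := b)) (g b)"
        using g sorted_env_update(2)[OF that(1,3)] that(2,3)
        by (intro tracesD[of "S - {n}" _ "c(n := b)"]) auto
      also have "\<dots> \<longleftrightarrow> sat M1 e (g b)"
        using g G(2) that(3) by (intro sat_cong) auto
      finally show ?thesis .
    qed
    let ?T = "g ` univ M2"
    have T: "?T \<subseteq> G" using g by auto
    have "traces S (Ex n \<phi>) c (Disj (Ex n \<alpha>) (\<Delta> ?T))"
      unfolding traces_def using first second by (simp add: univ_sum \<Delta>(3)[OF T] bex_Un)
    then show "\<exists>\<gamma>\<in>?H. traces S (Ex n \<phi>) c \<gamma>"
      using \<alpha>(1) T by (intro bexI[of _ "Disj (Ex n \<alpha>) (\<Delta> ?T)"]) auto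
  qed
qed

text \<open>
  The set \<open>S\<close> varies in the induction, since a quantified variable ranges over both summands and
  is put into \<open>S\<close> for one of them and taken out of it for the other.
\<close>

lemma finitely_many_traces:
  assumes "A \<subseteq> univ U" "fm_over U A \<phi>"
  shows "finitely_traced A S \<phi>"
  using assms(2)
proof (induction \<phi> arbitrary: S)
  case (Eq s t)
  then show ?case using finitely_traced_Eq[OF assms(1)] by simp
next
  case (Pred p ts)
  then show ?case by (rule finitely_traced_Pred[OF assms(1)])
qed (simp_all add: finitely_traced_Neg finitely_traced_Conj finitely_traced_Ex)

text \<open>
  Here \<open>S = {0}\<close>: the formula has no free variable ranging over the second summand, so a single one
  of its traces describes it on the whole first summand.
\<close>

lemma definable_trace:
  assumes A: "A \<subseteq> univ U" and D: "D \<in> definable_sets U A"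
  shows "D \<inter> univ M1 \<in> definable_sets M1 (univ M1 \<inter> A)"
proof -
  obtain \<phi> where \<phi>: "fm_over U A \<phi>" "fv \<phi> \<subseteq> {0}" and D: "D = {b \<in> univ U. holds_at U \<phi> b}"
    using D unfolding definable_sets_def by blast
  obtain a c where a: "a \<in> univ M1" and c: "c \<in> univ M2"
    using structures unfolding pred_structure_def by blast
  \<comment> \<open>Only variable 0 occurs free, so the element \<open>c\<close> assigned to all other variables is a dummy.\<close>
  let ?e = "\<lambda>b. (\<lambda>_. c)(0 := b)"
  have sorted: "sorted_env {0} (?e b)" if "b \<in> univ M1" for b
    using that c unfolding sorted_env_def by simp
  from finitely_many_traces[OF A \<phi>(1), of "{0}"] sorted[OF a]
  obtain \<alpha> where \<alpha>: "fm_over M1 (univ M1 \<inter> A) \<alpha>" "fv \<alpha> \<subseteq> {0}" "traces {0} \<phi> (?e a) \<alpha>"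
    unfolding finitely_traced_def by blast
  have "holds_at U \<phi> b \<longleftrightarrow> holds_at M1 \<alpha> b" if "b \<in> univ M1" for b
  proof -
    have "holds_at U \<phi> b \<longleftrightarrow> sat U (?e b) \<phi>"
      unfolding holds_at_def using \<phi>(2) by (intro sat_cong) auto
    also have "\<dots> \<longleftrightarrow> sat M1 (?e b) \<alpha>"
      using \<alpha>(3) sorted[OF that] unfolding traces_def by auto
    also have "\<dots> \<longleftrightarrow> holds_at M1 \<alpha> b"
      unfolding holds_at_def using \<alpha>(2) by (intro sat_cong) auto
    finally show ?thesis .
  qed
  then have "D \<inter> univ M1 = {b \<in> univ M1. holds_at M1 \<alpha> b}"
    unfolding D by (auto simp: univ_sum)
  with \<alpha>(1,2) show ?thesis unfolding definable_sets_def by blast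
qed

subsection \<open>Types of elements of the first summand\<close>

lemma solutions_tp_sum:
  assumes A: "A \<subseteq> univ U" and a: "a \<in> univ M1"
  shows "solutions U (tp U A a) = solutions M1 (tp M1 (univ M1 \<inter> A) a)"
proof -
  have "a \<in> univ U" using a univ_sum by simp
  have M1: "univ M1 \<in> definable_sets U A"
    by (intro definable_in_sum univ_definable)
  have "(\<forall>D\<in>definable_sets U A. a \<in> D \<longrightarrow> b \<in> D) \<longleftrightarrow>
      b \<in> univ M1 \<and> (\<forall>D\<in>definable_sets M1 (univ M1 \<inter> A). a \<in> D \<longrightarrow> b \<in> D)" for b
    using M1 a definable_in_sum[of _ A] definable_trace[OF A] by blast
  with solutions_tp_eq[OF a] solutions_tp_eq[OF \<open>a \<in> univ U\<close>] show ?thesis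
    by (auto simp: univ_sum)
qed

lemma algebraic_tp_sum:
  assumes A: "A \<subseteq> univ U" and a: "a \<in> univ M1"
  shows "algebraic_type U (tp U A a) \<longleftrightarrow> algebraic_type M1 (tp M1 (univ M1 \<inter> A) a)"
proof -
  have "a \<in> univ U" using a univ_sum by simp
  have "(\<exists>D\<in>definable_sets U A. a \<in> D \<and> finite D) \<longleftrightarrow>
      (\<exists>D\<in>definable_sets M1 (univ M1 \<inter> A). a \<in> D \<and> finite D)"
    using a definable_in_sum[of _ A] definable_trace[OF A] by (blast intro: finite_Int)
  with algebraic_tp_iff[OF a] algebraic_tp_iff[OF \<open>a \<in> univ U\<close>] show ?thesis
    by simp
qed

lemma ind_rig_first_summand:
  assumes "A \<subseteq> univ U"
  shows "(SUP a\<in>{a \<in> univ M1. algebraic_type U (tp U A a)}. enat (card (solutions U (tp U A a))))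
    = ind_rig M1 (univ M1 \<inter> A)"
  unfolding ind_rig_def
  using algebraic_tp_sum[OF assms] solutions_tp_sum[OF assms]
  by (intro SUP_cong) auto

end

lemma ind_rig_disjoint_sum:
  assumes sum: "disjoint_sum U M1 M2 P1 P2" and A: "A \<subseteq> univ U"
  shows "ind_rig U A = max (ind_rig M1 (univ M1 \<inter> A)) (ind_rig M2 (univ M2 \<inter> A))"
proof -
  let ?X = "\<lambda>M. {a \<in> univ M. algebraic_type U (tp U A a)}"
  have "?X U = ?X M1 \<union> ?X M2"
    using disjoint_sum.univ_sum[OF sum] by auto
  then have "ind_rig U A = sup (SUP a\<in>?X M1. enat (card (solutions U (tp U A a))))
      (SUP a\<in>?X M2. enat (card (solutions U (tp U A a))))"
    unfolding ind_rig_def by (simp only: SUP_union)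
  then show ?thesis
    using disjoint_sum.ind_rig_first_summand[OF sum A]
      disjoint_sum.ind_rig_first_summand[OF disjoint_sum_commute[OF sum] A]
    by (simp add: sup_max)
qed

theorem theorem4p3:
  fixes M1 M2 :: "('a, 'p) pstruct" and P1 P2 :: 'p and A :: "'a set"
  assumes "pred_structure M1" and "pred_structure M2"
    and "univ M1 \<inter> univ M2 = {}"
    and "lang M1 \<inter> lang M2 = {}"
    and "P1 \<notin> lang M1 \<union> lang M2" and "P2 \<notin> lang M1 \<union> lang M2" and "P1 \<noteq> P2"
    and "A \<subseteq> univ M1 \<union> univ M2"
  shows "ind_rig (disjoint_union P1 P2 M1 M2) A
           = max (ind_rig M1 (univ M1 \<inter> A)) (ind_rig M2 (univ M2 \<inter> A))"
proof (rule ind_rig_disjoint_sum)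
  show "disjoint_sum (disjoint_union P1 P2 M1 M2) M1 M2 P1 P2"
    using assms(1-7) by (rule disjoint_sum_disjoint_union)
  show "A \<subseteq> univ (disjoint_union P1 P2 M1 M2)"
    using assms(8) by (simp add: disjoint_union_def)
qed

end
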